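(* Let $1\le n\le m$ and let $\mathcal{F}$ be the foliation of $\mathbb{R}^m$ whose leaves are the $n$-dimensional planes $\{x_{n+1}=c_{n+1},\dots,x_m=c_m\}$, $(c_{n+1},\dots,c_m)\in\mathbb{R}^{m-n}$. For $i=1,\dots,n$ let $\Phi_i:\mathbb{R}^m\times\mathbb{R}\to\mathbb{R}^m$ be the flow $$\Phi_i(x_1,\dots,x_i,\dots,x_m,t)=(x_1,\dots,x_i+t,\dots,x_m)$$ generated by $F_i=\partial/\partial x_i$. Let $f=(f_1,\dots,f_m):\mathbb{R}^m\to\mathbb{R}^m$ be a smooth map preserving each leaf of $\mathcal{F}$. Then $f$ is a smooth shift along $\Phi_1,\dots,\Phi_n$ via the functions $\alpha_i=f_i-x_i$, $i=1,\dots,n$; that is, for all $x\in\mathbb{R}^m$, $$f(x)=\Phi_n\bigl(\cdots\Phi_2(\Phi_1(x,\alpha_1(x)),\alpha_2(x))\cdots,\alpha_n(x)\bigr).$$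
   Context: Smooth means $C^\infty$. A map $f$ preserves each leaf of $\mathcal{F}$ if $f(L)\subset L$ for every leaf $L$. A map is a smooth shift along $\Phi_1,\dots,\Phi_n$ via $\alpha_1,\dots,\alpha_n$ if the $\alpha_i$ are smooth functions and $f$ is given by the displayed formula, in which every $\alpha_i$ is evaluated at the initial point $x$. *)

theory Defs
  imports "HOL-Analysis.Analysis"
begin

text \<open>
  \<open>C_k (Suc k) f\<close> asks that \<open>f\<close> is differentiable everywhere and that each of its directional
  derivatives \<open>x \<mapsto> Df(x)v\<close> is of class \<open>C\<^sup>k\<close>; in finite dimension this is the usual class \<open>C\<^sup>k\<^sup>+\<^sup>1\<close>.
\<close>

primrec C_k :: "nat \<Rightarrow> ('a::euclidean_space \<Rightarrow> 'b::real_normed_vector) \<Rightarrow> bool" where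
  "C_k 0 f \<longleftrightarrow> continuous_on UNIV f"
| "C_k (Suc k) f \<longleftrightarrow> (\<forall>x. f differentiable (at x)) \<and>
     (\<forall>v. C_k k (\<lambda>x. frechet_derivative f (at x) v))"

definition smooth :: "('a::euclidean_space \<Rightarrow> 'b::real_normed_vector) \<Rightarrow> bool" where
  "smooth f \<longleftrightarrow> (\<forall>k. C_k k f)"

text \<open>
  The space is \<open>real ^ 'm\<close> with \<open>m = CARD('m)\<close>. Since the index type carries no order, the numbering
  of the coordinates is given by a bijection \<open>e\<close> from \<open>{1..m}\<close> onto the indices:
  the coordinate \<open>x\<^sub>i\<close> is \<open>x $ e i\<close>, and \<open>\<partial>/\<partial>x\<^sub>i\<close> is the constant vector field \<open>axis (e i) 1\<close>.
\<close>

definition enumerates :: "(nat \<Rightarrow> 'm::finite) \<Rightarrow> bool" where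
  "enumerates e \<longleftrightarrow> bij_betw e {1..CARD('m)} UNIV"

definition plane :: "(nat \<Rightarrow> 'm::finite) \<Rightarrow> nat \<Rightarrow> (nat \<Rightarrow> real) \<Rightarrow> (real ^ 'm) set" where
  "plane e n c = {x. \<forall>j\<in>{n+1..CARD('m)}. x $ e j = c j}"

text \<open>A foliation is represented by the set of its leaves.\<close>

definition plane_foliation :: "(nat \<Rightarrow> 'm::finite) \<Rightarrow> nat \<Rightarrow> (real ^ 'm) set set" where
  "plane_foliation e n = range (plane e n)"

definition preserves_leaves :: "'a set set \<Rightarrow> ('a \<Rightarrow> 'a) \<Rightarrow> bool" where
  "preserves_leaves \<F> f \<longleftrightarrow> (\<forall>L\<in>\<F>. f ` L \<subseteq> L)"

definition coord_flow :: "(nat \<Rightarrow> 'm::finite) \<Rightarrow> nat \<Rightarrow> real ^ 'm \<Rightarrow> real \<Rightarrow> real ^ 'm" where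
  "coord_flow e i x t = (\<chi> j. if j = e i then x $ j + t else x $ j)"

lemma coord_flow_eq: "coord_flow e i x t = x + t *\<^sub>R axis (e i) 1"
  by (simp add: coord_flow_def vec_eq_iff axis_def)

text \<open>\<open>coord_flow e i\<close> is the flow generated by \<open>\<partial>/\<partial>x\<^sub>i\<close>.\<close>

lemma coord_flow_0: "coord_flow e i x 0 = x"
  by (simp add: coord_flow_eq)

lemma coord_flow_generator:
  "((\<lambda>t. coord_flow e i x t) has_vector_derivative axis (e i) 1) (at t)"
  unfolding coord_flow_eq by (auto intro!: derivative_eq_intros)

text \<open>
  All \<open>\<alpha> i\<close> are evaluated at the initial point \<open>x\<close>, not at the intermediate points;
  \<open>fold\<close> along \<open>[1, \<dots>, n]\<close> applies \<open>\<Phi> 1\<close> first and \<open>\<Phi> n\<close> last.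
\<close>

definition smooth_shift ::
  "nat \<Rightarrow> (nat \<Rightarrow> 'a::euclidean_space \<Rightarrow> real \<Rightarrow> 'a) \<Rightarrow> (nat \<Rightarrow> 'a \<Rightarrow> real) \<Rightarrow> ('a \<Rightarrow> 'a) \<Rightarrow> bool" where
  "smooth_shift n \<Phi> \<alpha> f \<longleftrightarrow>
     (\<forall>i\<in>{1..n}. smooth (\<alpha> i)) \<and>
     (\<forall>x. f x = fold (\<lambda>i y. \<Phi> i y (\<alpha> i x)) [1..<n+1] x)"

end

theory Submission
  imports Defs
begin

text \<open>
  A map that preserves every plane parallel to the first \<open>n\<close> coordinate directions cannot change
  the remaining coordinates of a point, because those coordinates are the constants that determine
  the leaf through it. So \<open>f x - x\<close> is a combination of the first \<open>n\<close> coordinate vectors, with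
  coefficients \<open>\<alpha> i x\<close>. The flow \<open>\<Phi> i\<close> only adds its time to the \<open>i\<close>-th coordinate, and the times
  are fixed in advance by the initial point; running the flows through these times therefore
  adds exactly \<open>\<alpha> i x\<close> to each of the first \<open>n\<close> coordinates (\<open>fold_coord_flow_nth\<close>) and arrives at \<open>f x\<close>.

  The functions \<open>\<alpha> i\<close> are smooth because they arise from the smooth map \<open>f - id\<close> by applying a
  coordinate functional: classes of differentiability are stable under differences
  (\<open>C_k_diff\<close>) and under bounded linear maps (\<open>C_k_bounded_linear_compose\<close>).
\<close>

lemma C_k_const: "C_k k (\<lambda>x. c)"
  by (induction k arbitrary: c) (simp_all add: frechet_derivative_const)

text \<open>The derivative of a linear map is the same at every point, so its directional derivatives are constant.\<close>

lemma C_k_bounded_linear: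
  assumes "bounded_linear h"
  shows "C_k k h"
proof (cases k)
  case 0
  then show ?thesis
    using assms by (simp add: linear_continuous_on)
next
  case (Suc l)
  have D: "(h has_derivative h) (at x)" for x
    by (rule bounded_linear_imp_has_derivative[OF assms])
  show ?thesis
    by (simp add: Suc C_k_const differentiableI[OF D] frechet_derivative_at[OF D, symmetric])
qed

text \<open>Directional derivatives commute with bounded linear maps, which carries the induction on \<open>k\<close>.\<close>

lemma C_k_bounded_linear_compose:
  assumes "bounded_linear h" and "C_k k g"
  shows "C_k k (\<lambda>x. h (g x))"
  using assms(2)
proof (induction k arbitrary: g)
  case 0
  then show ?case
    using bounded_linear.continuous_on[OF assms(1)] by simp
next
  case (Suc k)
  have D: "((\<lambda>x. h (g x)) has_derivative (\<lambda>v. h (frechet_derivative g (at x) v))) (at x)" for x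
    using Suc.prems by (intro bounded_linear.has_derivative[OF assms(1)])
      (simp add: frechet_derivative_works[symmetric])
  show ?case
    using Suc by (simp add: differentiableI[OF D] frechet_derivative_at[OF D, symmetric])
qed

lemma C_k_diff:
  assumes "C_k k f" and "C_k k g"
  shows "C_k k (\<lambda>x. f x - g x)"
  using assms
proof (induction k arbitrary: f g)
  case 0
  then show ?case
    by (simp add: continuous_on_diff)
next
  case (Suc k)
  have D: "((\<lambda>x. f x - g x) has_derivative
      (\<lambda>v. frechet_derivative f (at x) v - frechet_derivative g (at x) v)) (at x)" for x
    using Suc.prems by (intro has_derivative_diff) (simp_all add: frechet_derivative_works[symmetric])
  show ?case
    using Suc by (simp add: differentiableI[OF D] frechet_derivative_at[OF D, symmetric])
qed

text \<open>
  Each flow moves a single coordinate, and distinct positions in the list move distinct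
  coordinates, so every coordinate is shifted at most once.
\<close>

lemma fold_coord_flow_nth:
  assumes "inj_on e S" and "k \<in> S" and "distinct is" and "set is \<subseteq> S"
  shows "fold (\<lambda>i y. coord_flow e i y (t i)) is y $ e k = y $ e k + (if k \<in> set is then t k else 0)"
  using assms(3,4)
proof (induction "is" arbitrary: y)
  case Nil
  then show ?case by simp
next
  case (Cons i "is")
  have "e k = e i \<longleftrightarrow> k = i"
    using assms(1,2) Cons.prems by (auto dest: inj_onD)
  then show ?case
    using Cons by (auto simp: coord_flow_def)
qed

lemma preserves_plane_foliation_nth:
  assumes "preserves_leaves (plane_foliation e n) f" and "j \<in> {n+1..CARD('m)}"
  shows "f x $ e j = (x :: real ^ 'm::finite) $ e j"
proof -
  \<comment> \<open>The leaf through \<open>x\<close> is the one whose constants are the coordinates of \<open>x\<close>.\<close>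
  let ?L = "plane e n (\<lambda>j. x $ e j)"
  have "x \<in> ?L"
    by (simp add: plane_def)
  moreover have "f ` ?L \<subseteq> ?L"
    using assms(1) by (simp add: preserves_leaves_def plane_foliation_def)
  ultimately have "f x \<in> ?L"
    by blast
  then show ?thesis
    using assms(2) by (simp add: plane_def)
qed

theorem lemma4p1p1:
  fixes e :: "nat \<Rightarrow> 'm::finite" and n :: nat and f :: "real ^ 'm \<Rightarrow> real ^ 'm"
  assumes "enumerates e"
    and "1 \<le> n" and "n \<le> CARD('m)"
    and "smooth f"
    and "preserves_leaves (plane_foliation e n) f"
  shows "smooth_shift n (coord_flow e) (\<lambda>i x. f x $ e i - x $ e i) f"
  unfolding smooth_shift_def
proof (intro conjI ballI allI)
  fix i
  have "C_k k (\<lambda>x. f x - x)" for k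
    using assms(4) by (simp add: smooth_def C_k_diff C_k_bounded_linear[OF bounded_linear_ident])
  then have "C_k k (\<lambda>x. (f x - x) $ e i)" for k
    by (rule C_k_bounded_linear_compose[OF bounded_linear_vec_nth])
  then show "smooth (\<lambda>x. f x $ e i - x $ e i)"
    by (simp add: smooth_def)
next
  fix x
  let ?y = "fold (\<lambda>i y. coord_flow e i y (f x $ e i - x $ e i)) [1..<n+1] x"
  have bij: "bij_betw e {1..CARD('m)} UNIV"
    using assms(1) by (simp add: enumerates_def)
  have coord: "f x $ e k = ?y $ e k" if k: "k \<in> {1..CARD('m)}" for k
  proof -
    have "?y $ e k = x $ e k + (if k \<in> set [1..<n+1] then f x $ e k - x $ e k else 0)"
      by (rule fold_coord_flow_nth[OF bij_betw_imp_inj_on[OF bij] k]) (use assms(3) in auto)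
    moreover have "f x $ e k = x $ e k" if "k \<notin> set [1..<n+1]"
      by (rule preserves_plane_foliation_nth[OF assms(5)]) (use k that in auto)
    ultimately show ?thesis
      by (cases "k \<in> set [1..<n+1]") (simp_all only: if_True if_False simp_thms
          add_0_right add.commute diff_add_cancel)
  qed
  show "f x = ?y"
  proof (rule vec_eq_iff[THEN iffD2], rule allI)
    fix j
    have "j \<in> e ` {1..CARD('m)}"
      using bij_betw_imp_surj_on[OF bij] by simp
    then obtain k where "j = e k" and "k \<in> {1..CARD('m)}"
      by (rule imageE)
    then show "f x $ j = ?y $ j"
      using coord by (simp only:)
  qed
qed

end
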